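(* Let $\mathcal G=(V,E)$ be a finite $\star$-directed graph. Let $i_0\in V$ be the starting point of the $\star$-ERRW $(X_n)_{n\in\mathbb N}$ and suppose that the positive initial weights $(\alpha_e)_{e\in E}$, with $\alpha_{i,j}=\alpha_{j^*,i^*}$ for all $(i,j)\in E$, have the property $$\mathrm{div}(\alpha)=\delta_{i_0^*}-\delta_{i_0}.$$ Then the $\star$-ERRW $(X_n)$ is partially exchangeable in the sense of Diaconis and Freedman. More precisely, if $\sigma=(\sigma_0,\dots,\sigma_n)$ is a directed path in $\mathcal G$ with $\sigma_0=i_0$, set $\alpha_e(\sigma)=\alpha_e+\overline n_e(\sigma)$, where $\overline n_{(i,j)}(\sigma)$ is the total number of crossings of the oriented edges $(i,j)$ and $(j^*,i^* )$ along the path $\sigma$. Then $$\mathbb P(X_0=\sigma_0,\dots,X_n=\sigma_n)=\frac{\gamma(\sigma_n,\alpha(\sigma))}{\gamma(\sigma_0,\alpha)}.$$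
   Context: A $\star$-directed graph is a directed graph $\mathcal G=(V,E)$ with an involution $i\mapsto i^*$ of $V$ such that $(i,j)\in E\iff(j^*,i^* )\in E$. Write $i\to j$ for $(i,j)\in E$. $V_0=\{i\in V:i=i^*\}$, and $V_1\subseteq V$ is a fixed subset with $V=V_0\sqcup V_1\sqcup V_1^*$. $\tilde E\subseteq E$ is a fixed set containing exactly one representative of each equivalence class of the relation $(i,j)\sim(j^*,i^* )$. For $x\in\mathbb R^E$, $x_i=\sum_{j:\,i\to j}x_{i,j}$ and $\mathrm{div}(x)(i)=\sum_{j:\,i\to j}x_{i,j}-\sum_{j:\,j\to i}x_{j,i}$. $\delta_k$ is the function on $V$ equal to $1$ at $k$ and $0$ elsewhere. $\star$-ERRW: $X_0=i_0$; $N_{i,j}(n)=\#\{0\le k\le n-1:(X_k,X_{k+1})=(i,j)\}$; $\alpha_{i,j}(n)=\alpha_{i,j}+N_{i,j}(n)+N_{j^*,i^*}(n)$; and $\mathbb P(X_{n+1}=j\mid X_0,\dots,X_n)=\mathbf 1_{X_n\to j}\,\alpha_{X_n,j}(n)/\sum_{l:\,X_n\to l}\alpha_{X_n,l}(n)$ (every vertex is understood to have an outgoing edge). For $k\in V$ and positive weights $\alpha$ with $\alpha_{i,j}=\alpha_{j^*,i^*}$, $$\gamma(k,\alpha)=\frac{\prod_{(i,j)\in\tilde E}\Gamma(\alpha_{i,j})}{\Big(\prod_{i\in V_0}\Gamma\big(\tfrac12(\alpha_i+1-\delta_{k}(i))\big)\,2^{\frac12(\alpha_i-\delta_{k}(i))}\Big)\Big(\prod_{i\in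 V_1}\Gamma(\min(\alpha_i,\alpha_{i^*}))\Big)}.$$ Partial exchangeability (Diaconis–Freedman): any two paths with the same starting point and the same number of transitions from $i$ to $j$ for every pair $(i,j)$ have the same probability.
   Formalization: The displayed probability formula is stated only for directed paths that never cross a self-dual edge (i,i* ), since it fails for paths crossing one (one vertex, loop of weight a: probability 1, ratio a+1); partial exchangeability is unrestricted. *)

theory Defs
  imports "HOL-Probability.Probability"
begin

locale star_digraph =
  fixes V :: "'v set" and E :: "('v \<times> 'v) set" and star :: "'v \<Rightarrow> 'v"
  assumes edges_subset: "E \<subseteq> V \<times> V"
    and star_closed: "\<And>i. i \<in> V \<Longrightarrow> star i \<in> V"
    and star_involution: "\<And>i. i \<in> V \<Longrightarrow> star (star i) = i"
    and star_edges: "\<And>i j. i \<in> V \<Longrightarrow> j \<in> V \<Longrightarrow> (i, j) \<in> E \<longleftrightarrow> (star j, star i) \<in> E"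

fun dual_edge :: "('v \<Rightarrow> 'v) \<Rightarrow> 'v \<times> 'v \<Rightarrow> 'v \<times> 'v" where
  "dual_edge star (i, j) = (star j, star i)"

definition self_dual_vertices :: "'v set \<Rightarrow> ('v \<Rightarrow> 'v) \<Rightarrow> 'v set" where
  "self_dual_vertices V star = {i \<in> V. i = star i}"

definition star_splitting :: "'v set \<Rightarrow> ('v \<Rightarrow> 'v) \<Rightarrow> 'v set \<Rightarrow> bool" where
  "star_splitting V star V1 \<longleftrightarrow>
     V = self_dual_vertices V star \<union> V1 \<union> star ` V1 \<and>
     disjnt (self_dual_vertices V star) V1 \<and>
     disjnt (self_dual_vertices V star) (star ` V1) \<and>
     disjnt V1 (star ` V1)"

definition edge_duality :: "('v \<times> 'v) set \<Rightarrow> ('v \<Rightarrow> 'v) \<Rightarrow> (('v \<times> 'v) \<times> ('v \<times> 'v)) set" where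
  "edge_duality E star = {(e, f). e \<in> E \<and> f \<in> E \<and> (f = e \<or> f = dual_edge star e)}"

definition edge_representatives ::
    "('v \<times> 'v) set \<Rightarrow> ('v \<Rightarrow> 'v) \<Rightarrow> ('v \<times> 'v) set \<Rightarrow> bool" where
  "edge_representatives E star R \<longleftrightarrow>
     R \<subseteq> E \<and> (\<forall>C \<in> E // edge_duality E star. \<exists>!e. e \<in> R \<inter> C)"

text \<open>Edge functions are total on pairs; only their values on \<open>E\<close> are ever used.\<close>

definition out_sum :: "('v \<times> 'v) set \<Rightarrow> ('v \<times> 'v \<Rightarrow> real) \<Rightarrow> 'v \<Rightarrow> real" where
  "out_sum E x i = (\<Sum>j | (i, j) \<in> E. x (i, j))"

definition divergence :: "('v \<times> 'v) set \<Rightarrow> ('v \<times> 'v \<Rightarrow> real) \<Rightarrow> 'v \<Rightarrow> real" where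
  "divergence E x i = (\<Sum>j | (i, j) \<in> E. x (i, j)) - (\<Sum>j | (j, i) \<in> E. x (j, i))"

definition delta :: "'v \<Rightarrow> 'v \<Rightarrow> real" where
  "delta k i = (if i = k then 1 else 0)"

text \<open>A finite path \<open>(x 0, \<dots>, x n)\<close> is a sequence \<open>x\<close> together with a length \<open>n\<close>; values of
  \<open>x\<close> beyond \<open>n\<close> are irrelevant.\<close>

definition transitions :: "(nat \<Rightarrow> 'v) \<Rightarrow> nat \<Rightarrow> 'v \<times> 'v \<Rightarrow> nat" where
  "transitions x n e = card {k. k < n \<and> (x k, x (Suc k)) = e}"

definition directed_path :: "('v \<times> 'v) set \<Rightarrow> (nat \<Rightarrow> 'v) \<Rightarrow> nat \<Rightarrow> bool" where
  "directed_path E x n \<longleftrightarrow> (\<forall>k<n. (x k, x (Suc k)) \<in> E)"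

text \<open>An edge that is its own dual, i.e. of the form \<open>(i, star i)\<close>, is counted twice in
  \<open>crossings\<close>, so that its weight grows by 2 at each crossing.\<close>

definition crossings :: "('v \<Rightarrow> 'v) \<Rightarrow> (nat \<Rightarrow> 'v) \<Rightarrow> nat \<Rightarrow> 'v \<times> 'v \<Rightarrow> nat" where
  "crossings star x n e = transitions x n e + transitions x n (dual_edge star e)"

definition reinforced ::
    "('v \<Rightarrow> 'v) \<Rightarrow> ('v \<times> 'v \<Rightarrow> real) \<Rightarrow> (nat \<Rightarrow> 'v) \<Rightarrow> nat \<Rightarrow> 'v \<times> 'v \<Rightarrow> real" where
  "reinforced star \<alpha> x n e = \<alpha> e + real (crossings star x n e)"

text \<open>The law of \<open>X (n + 1)\<close> given \<open>X 0, \<dots>, X n\<close> is specified by elementary conditioning on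
  each history of positive probability.\<close>

locale star_errw = star_digraph V E star + prob_space M
  for V :: "'v set" and E :: "('v \<times> 'v) set" and star :: "'v \<Rightarrow> 'v"
    and \<alpha> :: "'v \<times> 'v \<Rightarrow> real" and i0 :: 'v
    and M :: "'w measure" and X :: "nat \<Rightarrow> 'w \<Rightarrow> 'v" +
  assumes X_measurable: "\<And>n. X n \<in> M \<rightarrow>\<^sub>M count_space V"
    and X_start: "AE \<omega> in M. X 0 \<omega> = i0"
    and X_step: "\<And>n x j. j \<in> V \<Longrightarrow> \<P>(\<omega> in M. \<forall>k\<le>n. X k \<omega> = x k) > 0 \<Longrightarrow>
      \<P>(\<omega> in M. X (Suc n) \<omega> = j \<bar> \<forall>k\<le>n. X k \<omega> = x k) =
        (if (x n, j) \<in> E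
         then reinforced star \<alpha> x n (x n, j) / out_sum E (reinforced star \<alpha> x n) (x n)
         else 0)"

text \<open>The paths compared below are arbitrary finite sequences of states. Equal transition counts
  force equal lengths, so one \<open>n\<close> suffices.\<close>

definition partially_exchangeable :: "'w measure \<Rightarrow> (nat \<Rightarrow> 'w \<Rightarrow> 'v) \<Rightarrow> bool" where
  "partially_exchangeable M X \<longleftrightarrow>
     (\<forall>n \<sigma> \<tau>. \<sigma> 0 = \<tau> 0 \<and> (\<forall>i j. transitions \<sigma> n (i, j) = transitions \<tau> n (i, j)) \<longrightarrow>
        \<P>(\<omega> in M. \<forall>k\<le>n. X k \<omega> = \<sigma> k) = \<P>(\<omega> in M. \<forall>k\<le>n. X k \<omega> = \<tau> k))"

text \<open>The factor \<open>Gamma (\<alpha> e)\<close> is adapted to weights growing by 1. An edge \<open>(i, star i)\<close>, whose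
  weight grows by 2, would need \<open>Gamma (\<alpha> e / 2) * 2 powr (\<alpha> e / 2)\<close> instead. Ratios of
  \<open>gamma_const\<close> therefore give path probabilities only for paths that do not cross such an edge:
  on the graph with one vertex and one loop of weight \<open>a\<close>, the only path of length 1 has
  probability 1, whereas the corresponding ratio is \<open>a + 1\<close>.\<close>

definition gamma_const ::
    "'v set \<Rightarrow> ('v \<times> 'v) set \<Rightarrow> ('v \<Rightarrow> 'v) \<Rightarrow> 'v set \<Rightarrow> ('v \<times> 'v) set
      \<Rightarrow> 'v \<Rightarrow> ('v \<times> 'v \<Rightarrow> real) \<Rightarrow> real" where
  "gamma_const V E star V1 R k \<alpha> =
     (\<Prod>e\<in>R. Gamma (\<alpha> e)) /
     ((\<Prod>i\<in>self_dual_vertices V star.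
         Gamma ((out_sum E \<alpha> i + 1 - delta k i) / 2) * 2 powr ((out_sum E \<alpha> i - delta k i) / 2)) *
      (\<Prod>i\<in>V1. Gamma (min (out_sum E \<alpha> i) (out_sum E \<alpha> (star i)))))"

end

theory Submission
  imports Defs
begin

text \<open>Replacing \<open>Gamma (\<alpha> e)\<close> by \<open>Gamma (\<alpha> e / 2) * 2 powr (\<alpha> e / 2)\<close> for the edges that are their
  own dual turns the closed formula into one that is valid for all directed paths. It is shown by
  induction on the length of the path: the walk at \<open>k\<close> preserves the condition that the divergence
  of the current weights is \<open>delta (star k) - delta k\<close>, and under this condition a step along
  \<open>(k, l)\<close> multiplies the numerator by the weight of \<open>(k, l)\<close> and the denominator by the out-sum at
  \<open>k\<close>. Partial exchangeability follows because the transition counts and the starting point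
  determine the weights and the end point.\<close>

section \<open>Transition counts and the effect of one crossing on the weights\<close>

lemma prod_change_one:
  fixes f g :: "'b \<Rightarrow> 'c :: comm_monoid_mult"
  assumes "finite A" "r \<in> A" "f r = c * g r" "\<And>x. x \<in> A \<Longrightarrow> x \<noteq> r \<Longrightarrow> f x = g x"
  shows "prod f A = c * prod g A"
proof -
  have "prod f (A - {r}) = prod g (A - {r})"
    using assms(4) by (intro prod.cong) auto
  then show ?thesis
    using assms(1-3) by (simp add: prod.remove[of A r] mult.assoc)
qed

lemma delta_eq_of_bool: "delta k i = of_bool (i = k)"
  by (simp add: delta_def)

lemma transitions_0: "transitions x 0 e = 0"
  by (simp add: transitions_def)

lemma transitions_Suc:
  "transitions x (Suc n) e = transitions x n e + of_bool (e = (x n, x (Suc n)))"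
proof -
  have "{k. k < Suc n \<and> (x k, x (Suc k)) = e} =
      {k. k < n \<and> (x k, x (Suc k)) = e} \<union> (if e = (x n, x (Suc n)) then {n} else {})"
    by (auto simp: less_Suc_eq)
  then show ?thesis
    by (simp add: transitions_def)
qed

lemma transitions_pos_iff: "transitions x n e > 0 \<longleftrightarrow> (\<exists>k<n. (x k, x (Suc k)) = e)"
  by (auto simp: transitions_def card_gt_0_iff)

text \<open>The two indicators are summed, not joined by a disjunction, so that an edge equal to its
  dual gains 2, in accordance with \<open>crossings\<close>.\<close>

definition add_crossing :: "('v \<Rightarrow> 'v) \<Rightarrow> 'v \<times> 'v \<Rightarrow> ('v \<times> 'v \<Rightarrow> real) \<Rightarrow> 'v \<times> 'v \<Rightarrow> real" where
  "add_crossing star e \<beta> f = \<beta> f + of_bool (f = e) + of_bool (dual_edge star f = e)"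

lemma reinforced_0: "reinforced star \<alpha> x 0 = \<alpha>"
  by (auto simp: reinforced_def crossings_def transitions_0)

lemma reinforced_Suc:
  "reinforced star \<alpha> x (Suc n) = add_crossing star (x n, x (Suc n)) (reinforced star \<alpha> x n)"
  by (rule ext) (simp add: reinforced_def crossings_def transitions_Suc add_crossing_def)

section \<open>The corrected constant and the recursions of its Gamma factors\<close>

definition vertex_const ::
    "'v set \<Rightarrow> ('v \<times> 'v) set \<Rightarrow> ('v \<Rightarrow> 'v) \<Rightarrow> 'v set \<Rightarrow> 'v \<Rightarrow> ('v \<times> 'v \<Rightarrow> real) \<Rightarrow> real" where
  "vertex_const V E star V1 k \<beta> =
     (\<Prod>i\<in>self_dual_vertices V star.
         Gamma ((out_sum E \<beta> i + 1 - delta k i) / 2) * 2 powr ((out_sum E \<beta> i - delta k i) / 2)) *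
      (\<Prod>i\<in>V1. Gamma (min (out_sum E \<beta> i) (out_sum E \<beta> (star i))))"

text \<open>Each branch solves \<open>f (b + s) = b * f b\<close>, where \<open>s\<close> is the
  amount by which a crossing raises the weight: 2 for a self-dual edge, 1 otherwise.\<close>

definition edge_factor :: "('v \<Rightarrow> 'v) \<Rightarrow> 'v \<times> 'v \<Rightarrow> real \<Rightarrow> real" where
  "edge_factor star e b =
     (if dual_edge star e = e then Gamma (b / 2) * 2 powr (b / 2) else Gamma b)"

text \<open>The denominator is that of \<open>gamma_const\<close>; only the numerator is corrected
  at self-dual edges.\<close>

definition path_const ::
    "'v set \<Rightarrow> ('v \<times> 'v) set \<Rightarrow> ('v \<Rightarrow> 'v) \<Rightarrow> 'v set \<Rightarrow> ('v \<times> 'v) set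
      \<Rightarrow> 'v \<Rightarrow> ('v \<times> 'v \<Rightarrow> real) \<Rightarrow> real" where
  "path_const V E star V1 R k \<beta> =
     (\<Prod>e\<in>R. edge_factor star e (\<beta> e)) / vertex_const V E star V1 k \<beta>"

lemma edge_factor_pos: "b > 0 \<Longrightarrow> edge_factor star e b > 0"
  by (simp add: edge_factor_def Gamma_real_pos)

text \<open>The exponent \<open>c\<close> is independent of \<open>b\<close> because a self-dual
  edge needs \<open>c = b\<close>, while the factor of a self-dual current vertex needs
  \<open>c = b - 1\<close>.\<close>

lemma Gamma_half_step:
  fixes b :: real
  assumes "b > 0"
  shows "Gamma ((b + 2) / 2) * 2 powr ((c + 2) / 2) = b * (Gamma (b / 2) * 2 powr (c / 2))"
proof -
  have "Gamma ((b + 2) / 2) = b / 2 * Gamma (b / 2)"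
    using Gamma_plus1[of "b / 2"] assms by (simp add: add_divide_distrib nonpos_Ints_def)
  moreover have "2 powr ((c + 2) / 2) = 2 * 2 powr (c / 2)"
    by (simp add: add_divide_distrib powr_add)
  ultimately show ?thesis
    by simp
qed

lemma Gamma_step: "b > 0 \<Longrightarrow> Gamma (b + 1) = b * Gamma (b :: real)"
  by (rule Gamma_plus1) (auto simp: nonpos_Ints_def)

section \<open>Dual edges, and divergence of transition counts\<close>

context star_digraph
begin

lemma dual_edge_in_E: "e \<in> E \<Longrightarrow> dual_edge star e \<in> E"
  using edges_subset star_edges by (cases e) auto

lemma dual_edge_dual_edge: "e \<in> E \<Longrightarrow> dual_edge star (dual_edge star e) = e"
  using edges_subset star_involution by (cases e) auto

lemma star_eq_iff: "i \<in> V \<Longrightarrow> j \<in> V \<Longrightarrow> star i = j \<longleftrightarrow> i = star j"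
  using star_involution by auto

text \<open>The class of \<open>e\<close> consists of \<open>e\<close> and its dual, which may
  coincide. The intersection form covers both cases and also shows that \<open>R\<close> meets the
  class only in \<open>r\<close>.\<close>

lemma representative_of_edge:
  assumes "edge_representatives E star R" "e \<in> E"
  obtains r where "R \<inter> {e, dual_edge star e} = {r}"
proof -
  have "edge_duality E star `` {e} = {e, dual_edge star e}"
    using assms(2) dual_edge_in_E[OF assms(2)] by (auto simp: edge_duality_def)
  moreover have "edge_duality E star `` {e} \<in> E // edge_duality E star"
    using assms(2) by (rule quotientI)
  ultimately have "\<exists>!r. r \<in> R \<inter> {e, dual_edge star e}"
    using assms(1) unfolding edge_representatives_def by metis
  then show thesis
    using that by blast
qed

lemma sum_out_indicator:
  assumes "finite V" "(k, l) \<in> E"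
  shows "(\<Sum>j | (i, j) \<in> E. of_bool ((i, j) = (k, l))) = (of_bool (i = k) :: real)"
proof -
  have "finite {j. (i, j) \<in> E}"
    by (rule finite_subset[OF _ assms(1)]) (use edges_subset in auto)
  \<comment> \<open>Only \<open>j = l\<close> can contribute; if \<open>i \<noteq> k\<close> this
    term is zero as well, whether or not \<open>(i, l)\<close> is an edge.\<close>
  then have "(\<Sum>j | (i, j) \<in> E. if j = l then of_bool (i = k) else 0) = (of_bool (i = k) :: real)"
    using assms(2) by (subst sum.delta) auto
  then show ?thesis
    by (simp add: of_bool_def if_distrib cong: if_cong)
qed

lemma sum_in_indicator:
  assumes "finite V" "(k, l) \<in> E"
  shows "(\<Sum>j | (j, i) \<in> E. of_bool ((j, i) = (k, l))) = (of_bool (i = l) :: real)"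
proof -
  have "finite {j. (j, i) \<in> E}"
    by (rule finite_subset[OF _ assms(1)]) (use edges_subset in auto)
  then have "(\<Sum>j | (j, i) \<in> E. if j = k then of_bool (i = l) else 0) = (of_bool (i = l) :: real)"
    using assms(2) by (subst sum.delta) auto
  then show ?thesis
    by (simp add: of_bool_def if_distrib cong: if_cong)
qed

text \<open>Each transition counts +1 at its source and -1 at its target, so the contributions
  telescope along the path.\<close>

lemma divergence_transitions:
  assumes "finite V" "directed_path E x n"
  shows "divergence E (\<lambda>e. real (transitions x n e)) i = delta (x 0) i - delta (x n) i"
  using assms(2)
proof (induction n)
  case 0
  show ?case by (simp add: divergence_def transitions_0)
next
  case (Suc n)
  have e: "(x n, x (Suc n)) \<in> E" and "directed_path E x n"
    using Suc.prems by (auto simp: directed_path_def)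
  with Suc.IH have "divergence E (\<lambda>e. real (transitions x n e)) i = delta (x 0) i - delta (x n) i"
    by blast
  then show ?case
    using sum_out_indicator[OF assms(1) e, of i] sum_in_indicator[OF assms(1) e, of i]
    by (simp add: divergence_def transitions_Suc sum.distrib delta_eq_of_bool del: prod.inject)
qed

text \<open>By telescoping, the divergence of the counts reveals the end point once the start is
  known; it suffices to evaluate it at \<open>x n\<close>.\<close>

lemma same_transitions_same_end:
  assumes "finite V" "directed_path E x n" "directed_path E y n" "x 0 = y 0"
    and "transitions x n = transitions y n"
  shows "x n = y n"
proof -
  have "delta (x 0) (x n) - delta (x n) (x n) = delta (y 0) (x n) - delta (y n) (x n)"
    unfolding divergence_transitions[OF assms(1,2), symmetric]
      divergence_transitions[OF assms(1,3), symmetric] assms(5) ..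
  then have "delta (y n) (x n) = delta (x n) (x n)"
    unfolding assms(4) by linarith
  then show ?thesis
    by (simp add: delta_eq_of_bool)
qed

text \<open>The raised edges are \<open>(k, l)\<close>, which leaves \<open>k\<close>, and its dual,
  which leaves \<open>star l\<close>. If they coincide, both indicators fire at
  \<open>k\<close>.\<close>

lemma out_sum_add_crossing:
  assumes "finite V" "(k, l) \<in> E" "i \<in> V"
  shows "out_sum E (add_crossing star (k, l) \<beta>) i =
    out_sum E \<beta> i + of_bool (i = k) + of_bool (i = star l)"
proof -
  have kl: "k \<in> V" "l \<in> V"
    using assms(2) edges_subset by auto
  have "(\<Sum>j | (i, j) \<in> E. of_bool (dual_edge star (i, j) = (k, l))) =
      (\<Sum>j | (i, j) \<in> E. of_bool ((i, j) = (star l, star k)))"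
    using edges_subset star_eq_iff kl assms(3) by (intro sum.cong) (auto simp: conj_commute)
  also have "\<dots> = (of_bool (i = star l) :: real)"
    using sum_out_indicator[OF assms(1), of "star l" "star k" i] star_edges kl assms(2) by blast
  finally show ?thesis
    using sum_out_indicator[OF assms(1,2), of i]
    by (simp add: out_sum_def add_crossing_def sum.distrib)
qed

end

section \<open>Symmetric positive weights and the balance condition\<close>

locale star_weights = star_digraph V E star
  for V :: "'v set" and E and star +
  fixes \<beta> :: "'v \<times> 'v \<Rightarrow> real"
  assumes finite_V: "finite V"
    and out_edge: "\<And>i. i \<in> V \<Longrightarrow> \<exists>j. (i, j) \<in> E"
    and weight_pos: "\<And>e. e \<in> E \<Longrightarrow> \<beta> e > 0"
    and weight_sym: "\<And>e. e \<in> E \<Longrightarrow> \<beta> (dual_edge star e) = \<beta> e"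
begin

lemma out_sum_pos: "i \<in> V \<Longrightarrow> out_sum E \<beta> i > 0"
  unfolding out_sum_def
proof (rule sum_pos)
  show "finite {j. (i, j) \<in> E}"
    by (rule finite_subset[OF _ finite_V]) (use edges_subset in auto)
qed (use out_edge weight_pos in auto)

text \<open>Duality maps the edges into \<open>i\<close> bijectively onto the edges out of
  \<open>star i\<close> and preserves weights. Hence the divergence can be expressed by out-sums
  alone.\<close>

lemma in_sum_eq:
  assumes "i \<in> V"
  shows "(\<Sum>j | (j, i) \<in> E. \<beta> (j, i)) = out_sum E \<beta> (star i)"
  unfolding out_sum_def
proof (rule sum.reindex_bij_witness[where i = star and j = star])
  fix j assume "j \<in> {j. (j, i) \<in> E}"
  then have e: "(j, i) \<in> E" and j: "j \<in> V"
    using edges_subset by auto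
  show "star (star j) = j" "star j \<in> {j. (star i, j) \<in> E}" "\<beta> (star i, star j) = \<beta> (j, i)"
    using e j assms star_involution star_edges weight_sym[OF e] by auto
next
  fix j assume "j \<in> {j. (star i, j) \<in> E}"
  then have e: "(star i, j) \<in> E" and j: "j \<in> V"
    using edges_subset by auto
  show "star (star j) = j" "star j \<in> {j. (j, i) \<in> E}"
    using dual_edge_in_E[OF e] j assms star_involution by auto
qed

lemma divergence_eq: "i \<in> V \<Longrightarrow> divergence E \<beta> i = out_sum E \<beta> i - out_sum E \<beta> (star i)"
  using in_sum_eq by (simp add: divergence_def out_sum_def)

text \<open>An edge and its dual are raised by the same amount, so symmetry survives. The locale can
  therefore be reinterpreted for the current weights of the walk.\<close>

lemma star_weights_add_crossing: "star_weights V E star (add_crossing star e \<beta>)"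
proof
  fix f assume f: "f \<in> E"
  show "add_crossing star e \<beta> f > 0"
    unfolding add_crossing_def using weight_pos[OF f] by (intro add_pos_nonneg) auto
  show "add_crossing star e \<beta> (dual_edge star f) = add_crossing star e \<beta> f"
    using f by (simp add: add_crossing_def weight_sym dual_edge_dual_edge)
qed (use finite_V out_edge in auto)

text \<open>The invariant of the walk: the hypothesis on the initial divergence, with the starting
  point replaced by the current vertex \<open>k\<close>.\<close>

definition balanced_at :: "'v \<Rightarrow> bool" where
  "balanced_at k \<longleftrightarrow> (\<forall>i\<in>V. divergence E \<beta> i = delta (star k) i - delta k i)"

text \<open>The crossing raises the out-sums at \<open>k\<close> and \<open>star l\<close>, so the
  divergence gains \<open>delta k - delta (star k) + delta (star l) - delta l\<close>, whose first
  two terms cancel the old divergence.\<close>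

lemma balanced_at_add_crossing:
  assumes "balanced_at k" "(k, l) \<in> E"
  shows "star_weights.balanced_at V E star (add_crossing star (k, l) \<beta>) l"
proof -
  interpret new: star_weights V E star "add_crossing star (k, l) \<beta>"
    by (rule star_weights_add_crossing)
  have kl: "k \<in> V" "l \<in> V"
    using assms(2) edges_subset by auto
  show ?thesis
    unfolding new.balanced_at_def
  proof
    fix i assume i: "i \<in> V"
    have "out_sum E \<beta> i - out_sum E \<beta> (star i) = delta (star k) i - delta k i"
      using assms(1) i by (simp add: balanced_at_def divergence_eq)
    moreover have "star i = k \<longleftrightarrow> i = star k" "star i = star l \<longleftrightarrow> i = l"
      using star_eq_iff[OF i kl(1)] star_eq_iff[OF i star_closed[OF kl(2)]] star_involution[OF kl(2)]
      by auto
    ultimately show "divergence E (add_crossing star (k, l) \<beta>) i = delta (star l) i - delta l i"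
      unfolding new.divergence_eq[OF i] out_sum_add_crossing[OF finite_V assms(2) i]
        out_sum_add_crossing[OF finite_V assms(2) star_closed[OF i]] delta_eq_of_bool by simp
  qed
qed

text \<open>Under balance the out-sums of a dual pair agree, except that the one at
  \<open>star k\<close> exceeds the one at \<open>k\<close> by 1 when \<open>k\<close> is not
  self-dual.\<close>

lemma min_out_sum:
  assumes "balanced_at k" "i \<in> V" "i \<noteq> star i" "k \<in> V"
  shows "min (out_sum E \<beta> i) (out_sum E \<beta> (star i)) = out_sum E \<beta> i - of_bool (i = star k)"
proof -
  have "out_sum E \<beta> i - out_sum E \<beta> (star i) = delta (star k) i - delta k i"
    using assms(1,2) by (simp add: balanced_at_def divergence_eq)
  moreover have "\<not> (i = star k \<and> i = k)"
    using assms(3) by auto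
  ultimately show ?thesis
    by (auto simp: delta_def split: if_splits)
qed

section \<open>Positivity and one-step recursions of the constants\<close>

lemma vertex_const_pos:
  assumes "V1 \<subseteq> V"
  shows "vertex_const V E star V1 k \<beta> > 0"
proof -
  have "(\<Prod>i\<in>self_dual_vertices V star. Gamma ((out_sum E \<beta> i + 1 - delta k i) / 2) *
      2 powr ((out_sum E \<beta> i - delta k i) / 2)) > 0"
  proof (rule prod_pos)
    fix i assume "i \<in> self_dual_vertices V star"
    then have "out_sum E \<beta> i > 0"
      by (auto simp: self_dual_vertices_def intro: out_sum_pos)
    then show "Gamma ((out_sum E \<beta> i + 1 - delta k i) / 2) *
        2 powr ((out_sum E \<beta> i - delta k i) / 2) > 0"
      \<comment> \<open>The \<open>+ 1\<close> compensates \<open>delta k i \<le> 1\<close>, so the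
        Gamma argument is at least half the out-sum.\<close>
      by (intro mult_pos_pos Gamma_real_pos) (auto simp: delta_def)
  qed
  moreover have "(\<Prod>i\<in>V1. Gamma (min (out_sum E \<beta> i) (out_sum E \<beta> (star i)))) > 0"
    using assms out_sum_pos star_closed by (intro prod_pos) (auto intro!: Gamma_real_pos)
  ultimately show ?thesis
    by (simp add: vertex_const_def)
qed

text \<open>Exactly one factor changes: that of \<open>k\<close> if \<open>k\<close> is self-dual,
  otherwise that of the member of \<open>V1\<close> among \<open>k\<close> and
  \<open>star k\<close>. The target \<open>l\<close> leaves no trace, since the gain at
  \<open>star l\<close> is offset by the shifted delta or by the minimum.\<close>

lemma vertex_const_step:
  assumes bal: "balanced_at k" and e: "(k, l) \<in> E" and split: "star_splitting V star V1"
  shows "vertex_const V E star V1 l (add_crossing star (k, l) \<beta>) =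
    out_sum E \<beta> k * vertex_const V E star V1 k \<beta>"
proof -
  let ?\<beta>' = "add_crossing star (k, l) \<beta>" and ?V0 = "self_dual_vertices V star"
  interpret new: star_weights V E star ?\<beta>'
    by (rule star_weights_add_crossing)
  have kl: "k \<in> V" "l \<in> V"
    using e edges_subset by auto
  have out: "out_sum E ?\<beta>' i = out_sum E \<beta> i + of_bool (i = k) + of_bool (i = star l)"
    if "i \<in> V" for i
    using out_sum_add_crossing[OF finite_V e that] .
  have V1: "V1 \<subseteq> V" "finite V1"
    using split finite_V unfolding star_splitting_def by (auto intro: finite_subset)
  have V0: "?V0 \<subseteq> V" "finite ?V0"
    using finite_V unfolding self_dual_vertices_def by auto
  define a where "a i = out_sum E \<beta> i - delta k i" for i
  define a' where "a' i = out_sum E ?\<beta>' i - delta l i" for i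
  define m where "m i = min (out_sum E \<beta> i) (out_sum E \<beta> (star i))" for i
  define m' where "m' i = min (out_sum E ?\<beta>' i) (out_sum E ?\<beta>' (star i))" for i
  have const: "vertex_const V E star V1 k \<beta> =
      (\<Prod>i\<in>?V0. Gamma ((a i + 1) / 2) * 2 powr (a i / 2)) * (\<Prod>i\<in>V1. Gamma (m i))"
    unfolding vertex_const_def a_def m_def by (simp add: algebra_simps)
  have const': "vertex_const V E star V1 l ?\<beta>' =
      (\<Prod>i\<in>?V0. Gamma ((a' i + 1) / 2) * 2 powr (a' i / 2)) * (\<Prod>i\<in>V1. Gamma (m' i))"
    unfolding vertex_const_def a'_def m'_def by (simp add: algebra_simps)
  \<comment> \<open>For self-dual \<open>i\<close> the gain at \<open>star l\<close> cancels against
    the new delta at \<open>l\<close>. At \<open>k\<close> the crossing adds 1 and the disappearance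
    of the old delta adds another 1.\<close>
  have a': "a' i = a i + 2 * of_bool (i = k)" if "i \<in> ?V0" for i
  proof -
    have i: "i \<in> V" "star i = i"
      using that by (auto simp: self_dual_vertices_def)
    then have "i = star l \<longleftrightarrow> i = l"
      using kl star_eq_iff by metis
    then show ?thesis
      using out[OF i(1)] by (auto simp: a_def a'_def delta_def)
  qed
  have V1_ne: "i \<noteq> star i" if "i \<in> V1" for i
    using that V1 split unfolding star_splitting_def self_dual_vertices_def disjnt_def by blast
  have m: "m i = out_sum E \<beta> i - of_bool (i = star k)" if "i \<in> V1" for i
    unfolding m_def using that V1 V1_ne bal kl by (intro min_out_sum) auto
  \<comment> \<open>Balance at \<open>l\<close> makes the new minimum subtract 1 exactly at
    \<open>star l\<close>, where the crossing has added 1.\<close>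
  have m': "m' i = m i + of_bool (i = k) + of_bool (i = star k)" if "i \<in> V1" for i
  proof -
    have "m' i = out_sum E ?\<beta>' i - of_bool (i = star l)"
      unfolding m'_def using that V1 V1_ne kl balanced_at_add_crossing[OF bal e]
      by (intro new.min_out_sum) auto
    then show ?thesis
      using m[OF that] out[of i] that V1 by auto
  qed
  have pos: "out_sum E \<beta> k > 0"
    using out_sum_pos kl by blast
  \<comment> \<open>Whichever of \<open>k\<close> and \<open>star k\<close> is in \<open>V1\<close>,
    the old minimum of the pair is the out-sum at \<open>k\<close>, the smaller one by balance, and
    it grows by 1.\<close>
  have other: "(\<Prod>i\<in>V1. Gamma (m' i)) = out_sum E \<beta> k * (\<Prod>i\<in>V1. Gamma (m i))"
    if "r \<in> V1" "r = k \<or> r = star k" for r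
  proof (rule prod_change_one)
    have ne: "k \<noteq> star k"
      using V1_ne[OF that(1)] that kl star_involution by auto
    have div: "out_sum E \<beta> k - out_sum E \<beta> (star k) = - 1"
      using bal kl(1) ne unfolding balanced_at_def by (simp add: divergence_eq delta_def)
    have "m r = out_sum E \<beta> k" "m' r = m r + 1"
      using m[OF that(1)] m'[OF that(1)] that(2) ne div by auto
    then show "Gamma (m' r) = out_sum E \<beta> k * Gamma (m r)"
      using pos Gamma_step by simp
    fix x assume x: "x \<in> V1" "x \<noteq> r"
    \<comment> \<open>\<open>V1\<close> contains only one vertex of each dual pair, so no other
      factor is affected.\<close>
    have "star x \<notin> V1"
      using x split unfolding star_splitting_def disjnt_def by blast
    then have "x \<noteq> k" "x \<noteq> star k"
      using x that kl star_involution by auto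
    then show "Gamma (m' x) = Gamma (m x)"
      using m'[OF x(1)] by simp
  qed (use V1 that in auto)
  show ?thesis
  proof (cases "k \<in> ?V0")
    case True
    then have ns: "star k = k"
      by (simp add: self_dual_vertices_def)
    have "k \<notin> V1"
      using True split unfolding star_splitting_def disjnt_def by blast
    then have "(\<Prod>i\<in>V1. Gamma (m' i)) = (\<Prod>i\<in>V1. Gamma (m i))"
      using m' ns by (intro prod.cong) auto
    moreover have "(\<Prod>i\<in>?V0. Gamma ((a' i + 1) / 2) * 2 powr (a' i / 2)) =
        out_sum E \<beta> k * (\<Prod>i\<in>?V0. Gamma ((a i + 1) / 2) * 2 powr (a i / 2))"
    proof (rule prod_change_one)
      show "Gamma ((a' k + 1) / 2) * 2 powr (a' k / 2) =
          out_sum E \<beta> k * (Gamma ((a k + 1) / 2) * 2 powr (a k / 2))"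
        using Gamma_half_step[OF pos, of "a k"] a'[OF True] by (simp add: a_def delta_def add.commute)
    qed (use V0 True a' in auto)
    ultimately show ?thesis
      by (simp add: const const' mult.assoc)
  next
    case False
    then have "(\<Prod>i\<in>?V0. Gamma ((a' i + 1) / 2) * 2 powr (a' i / 2)) =
        (\<Prod>i\<in>?V0. Gamma ((a i + 1) / 2) * 2 powr (a i / 2))"
      using a' by (intro prod.cong) auto
    moreover have "k \<in> V1 \<or> k \<in> star ` V1"
      using False kl split unfolding star_splitting_def by blast
    then have "k \<in> V1 \<or> star k \<in> V1"
      using V1 star_involution by auto
    then have "(\<Prod>i\<in>V1. Gamma (m' i)) = out_sum E \<beta> k * (\<Prod>i\<in>V1. Gamma (m i))"
      using other by blast
    ultimately show ?thesis
      by (simp add: const const')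
  qed
qed

text \<open>Only the representative of the class of \<open>e\<close> changes its factor. It may be
  the dual of \<open>e\<close>, but symmetry gives it the weight of \<open>e\<close>, and
  \<open>edge_factor\<close> is matched to the increment in both cases.\<close>

lemma edge_const_step:
  assumes "e \<in> E" "edge_representatives E star R"
  shows "(\<Prod>f\<in>R. edge_factor star f (add_crossing star e \<beta> f)) =
    \<beta> e * (\<Prod>f\<in>R. edge_factor star f (\<beta> f))"
proof -
  obtain r where r: "R \<inter> {e, dual_edge star e} = {r}"
    using representative_of_edge assms by blast
  have R: "R \<subseteq> E" "finite R"
    using assms(2) finite_V edges_subset
    by (auto simp: edge_representatives_def intro: finite_subset[of R "V \<times> V"])
  have dd: "dual_edge star (dual_edge star f) = f" if "f \<in> E" for f
    using dual_edge_dual_edge[OF that] .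
  show ?thesis
  proof (rule prod_change_one)
    have pos: "\<beta> e > 0"
      using weight_pos assms(1) by auto
    have r': "r = e \<or> r = dual_edge star e"
      using r by blast
    then have \<beta>r: "\<beta> r = \<beta> e"
      using weight_sym[OF assms(1)] by auto
    show "edge_factor star r (add_crossing star e \<beta> r) = \<beta> e * edge_factor star r (\<beta> r)"
    proof (cases "dual_edge star e = e")
      case True
      then have "r = e"
        using r' by auto
      then show ?thesis
        using True Gamma_half_step[OF pos, of "\<beta> e"]
          by (simp add: edge_factor_def add_crossing_def add.commute)
    next
      case False
      then have "dual_edge star r \<noteq> r"
        using r' dd[OF assms(1)] by auto
      moreover have "add_crossing star e \<beta> r = \<beta> e + 1"
        using r' False dd[OF assms(1)] \<beta>r by (auto simp: add_crossing_def)
      ultimately show ?thesis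
        using Gamma_step[OF pos] \<beta>r by (simp add: edge_factor_def)
    qed
    fix f assume f: "f \<in> R" "f \<noteq> r"
    then have "f \<noteq> e" "f \<noteq> dual_edge star e"
      using r by auto
    then have "add_crossing star e \<beta> f = \<beta> f"
      using dd[of f] f R by (auto simp: add_crossing_def)
    then show "edge_factor star f (add_crossing star e \<beta> f) = edge_factor star f (\<beta> f)"
      by simp
  qed (use R r in auto)
qed

lemma path_const_pos:
  assumes "star_splitting V star V1" "edge_representatives E star R"
  shows "path_const V E star V1 R k \<beta> > 0"
proof -
  have "R \<subseteq> E" "V1 \<subseteq> V"
    using assms by (auto simp: edge_representatives_def star_splitting_def)
  then show ?thesis
    unfolding path_const_def using weight_pos
    by (intro divide_pos_pos prod_pos vertex_const_pos) (auto intro!: edge_factor_pos)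
qed

text \<open>The multiplier is the probability of stepping from \<open>k\<close> to \<open>l\<close>
  under the weights \<open>\<beta>\<close>.\<close>

lemma path_const_step:
  assumes "balanced_at k" "(k, l) \<in> E" "star_splitting V star V1" "edge_representatives E star R"
  shows "path_const V E star V1 R l (add_crossing star (k, l) \<beta>) =
    \<beta> (k, l) / out_sum E \<beta> k * path_const V E star V1 R k \<beta>"
  using assms by (simp add: path_const_def vertex_const_step edge_const_step)

section \<open>Weights along whole paths and comparison with \<open>gamma_const\<close>\<close>

lemma star_weights_reinforced: "star_weights V E star (reinforced star \<beta> x n)"
proof (induction n)
  case 0
  show ?case by (simp add: reinforced_0 star_weights_axioms)
next
  case (Suc n)
  then show ?case by (simp add: reinforced_Suc star_weights.star_weights_add_crossing)
qed

lemma balanced_at_reinforced: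
  assumes "balanced_at (x 0)" "directed_path E x n"
  shows "star_weights.balanced_at V E star (reinforced star \<beta> x n) (x n)"
  using assms(2)
proof (induction n)
  case 0
  show ?case by (simp add: reinforced_0 assms(1))
next
  case (Suc n)
  then show ?case
    using star_weights.balanced_at_add_crossing[OF star_weights_reinforced]
    by (simp add: reinforced_Suc directed_path_def)
qed

text \<open>The two constants differ only in the factors of self-dual edges. A path avoiding these
  edges leaves their weights unchanged, so the discrepancy is the same at both ends and
  cancels.\<close>

lemma gamma_const_ratio_eq:
  assumes split: "star_splitting V star V1" and reps: "edge_representatives E star R"
    and no_self_dual: "\<forall>k<n. x (Suc k) \<noteq> star (x k)"
  shows "gamma_const V E star V1 R k (reinforced star \<beta> x n) / gamma_const V E star V1 R l \<beta> =
    path_const V E star V1 R k (reinforced star \<beta> x n) / path_const V E star V1 R l \<beta>"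
proof -
  define c where "c = (\<Prod>e\<in>R. Gamma (\<beta> e) / edge_factor star e (\<beta> e))"
  have R: "R \<subseteq> E"
    using reps by (auto simp: edge_representatives_def)
  have pos: "\<beta> e > 0" "edge_factor star e (\<beta> e) > 0" if "e \<in> R" for e
    using weight_pos[of e] edge_factor_pos[of "\<beta> e" star e] that R by auto
  have factor: "Gamma (reinforced star \<beta> x m e) =
      Gamma (\<beta> e) / edge_factor star e (\<beta> e) * edge_factor star e (reinforced star \<beta> x m e)"
    if "e \<in> R" "m \<le> n" for e m
  proof (cases "dual_edge star e = e")
    case True
    \<comment> \<open>A transition along a self-dual edge would have
      \<open>x (Suc j) = star (x j)\<close>.\<close>
    have "transitions x m e = 0"
    proof (rule ccontr)
      assume "transitions x m e \<noteq> 0"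
      then obtain j where "j < m" "(x j, x (Suc j)) = e"
        using transitions_pos_iff[of x m e] by auto
      moreover from this have "x (Suc j) \<noteq> star (x j)"
        using no_self_dual that(2) by simp
      ultimately show False
        using True by auto
    qed
    then have "reinforced star \<beta> x m e = \<beta> e"
      using True by (simp add: reinforced_def crossings_def)
    then show ?thesis
      using pos[OF that(1)] by simp
  next
    case False
    then show ?thesis
      using Gamma_real_pos[OF pos(1)[OF that(1)]] by (simp add: edge_factor_def)
  qed
  have const: "gamma_const V E star V1 R j (reinforced star \<beta> x m) =
      c * path_const V E star V1 R j (reinforced star \<beta> x m)" if "m \<le> n" for j m
  proof -
    have "(\<Prod>e\<in>R. Gamma (reinforced star \<beta> x m e)) =
        c * (\<Prod>e\<in>R. edge_factor star e (reinforced star \<beta> x m e))"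
      unfolding c_def prod.distrib[symmetric] using factor[OF _ that] by (intro prod.cong) auto
    then show ?thesis
      by (simp add: gamma_const_def path_const_def vertex_const_def)
  qed
  have "c > 0"
    unfolding c_def using pos by (intro prod_pos) (auto intro!: divide_pos_pos Gamma_real_pos)
  then show ?thesis
    using const[of n k] const[of 0 l] by (simp add: reinforced_0)
qed

end

section \<open>Probabilities of finite histories\<close>

context star_errw
begin

lemma sets_history: "{\<omega> \<in> space M. \<forall>k\<le>n. X k \<omega> = x k} \<in> sets M"
proof -
  have "{\<omega> \<in> space M. X k \<omega> = x k} \<in> sets M" for k
  proof -
    \<comment> \<open>Intersecting with \<open>V\<close> gives a set of \<open>count_space V\<close>
      even if \<open>x k\<close> lies outside \<open>V\<close>.\<close>
    have "X k -` ({x k} \<inter> V) \<inter> space M \<in> sets M"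
      by (rule measurable_sets[OF X_measurable]) auto
    moreover have "X k -` ({x k} \<inter> V) \<inter> space M = {\<omega> \<in> space M. X k \<omega> = x k}"
      using measurable_space[OF X_measurable[of k]] by auto
    ultimately show ?thesis
      by simp
  qed
  then show ?thesis
    by (auto intro!: sets.sets_Collect)
qed

lemma prob_start: "\<P>(\<omega> in M. \<forall>k\<le>0. X k \<omega> = x k) = of_bool (x 0 = i0)"
proof (cases "x 0 = i0")
  case True
  then have "AE \<omega> in M. \<forall>k\<le>0. X k \<omega> = x k"
    using X_start by auto
  then show ?thesis
    using True prob_Collect_eq_1[OF sets_history[of 0 x]] by simp
next
  case False
  then have "AE \<omega> in M. \<not> (\<forall>k\<le>0. X k \<omega> = x k)"
    using X_start by auto
  then show ?thesis
    using False prob_Collect_eq_0[OF sets_history[of 0 x]] by simp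
qed

text \<open>\<open>X_step\<close> covers histories of positive probability and next states in
  \<open>V\<close>. Otherwise both sides vanish: a null history has null extensions, and a next
  state outside \<open>V\<close> is neither reached nor the end of an edge.\<close>

lemma prob_path_Suc:
  "\<P>(\<omega> in M. \<forall>k\<le>Suc n. X k \<omega> = x k) = \<P>(\<omega> in M. \<forall>k\<le>n. X k \<omega> = x k) *
     (if (x n, x (Suc n)) \<in> E
      then reinforced star \<alpha> x n (x n, x (Suc n)) / out_sum E (reinforced star \<alpha> x n) (x n)
      else 0)"
proof -
  let ?H = "\<lambda>\<omega>. \<forall>k\<le>n. X k \<omega> = x k"
  have ev: "(\<forall>k\<le>Suc n. X k \<omega> = x k) \<longleftrightarrow> X (Suc n) \<omega> = x (Suc n) \<and> ?H \<omega>" for \<omega>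
    by (auto simp: le_Suc_eq)
  show ?thesis
  proof (cases "\<P>(\<omega> in M. ?H \<omega>) > 0")
    case False
    then have zero: "\<P>(\<omega> in M. ?H \<omega>) = 0"
      by (simp add: zero_less_measure_iff)
    have "\<P>(\<omega> in M. \<forall>k\<le>Suc n. X k \<omega> = x k) \<le> \<P>(\<omega> in M. ?H \<omega>)"
      by (rule finite_measure_mono[OF _ sets_history]) auto
    then have "\<P>(\<omega> in M. \<forall>k\<le>Suc n. X k \<omega> = x k) = 0"
      using zero measure_nonneg[of M] by (simp add: order_antisym)
    then show ?thesis
      using zero by simp
  next
    case True
    show ?thesis
    proof (cases "x (Suc n) \<in> V")
      case in_V: True
      show ?thesis
        using X_step[OF in_V True] True
        by (simp add: cond_prob_def ev nonzero_divide_eq_eq mult.commute)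
    next
      case False
      then have "{\<omega> \<in> space M. \<forall>k\<le>Suc n. X k \<omega> = x k} = {}"
        using measurable_space[OF X_measurable[of "Suc n"]] unfolding ev by force
      moreover have "(x n, x (Suc n)) \<notin> E"
        using False edges_subset by auto
      ultimately show ?thesis
        by (simp only: measure_empty if_False mult_zero_right)
    qed
  qed
qed

end

theorem proposition1:
  fixes V :: "'v set" and E :: "('v \<times> 'v) set" and star :: "'v \<Rightarrow> 'v"
    and V1 :: "'v set" and R :: "('v \<times> 'v) set"
    and \<alpha> :: "'v \<times> 'v \<Rightarrow> real" and i0 :: 'v
    and M :: "'w measure" and X :: "nat \<Rightarrow> 'w \<Rightarrow> 'v"
  assumes "star_digraph V E star"
    and "finite V"
    and "\<forall>i\<in>V. \<exists>j. (i, j) \<in> E"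
    and "star_splitting V star V1"
    and "edge_representatives E star R"
    and "i0 \<in> V"
    and "\<forall>e\<in>E. \<alpha> e > 0"
    and "\<forall>(i, j)\<in>E. \<alpha> (i, j) = \<alpha> (star j, star i)"
    and "\<forall>i\<in>V. divergence E \<alpha> i = delta (star i0) i - delta i0 i"
    and "star_errw V E star \<alpha> i0 M X"
  shows "partially_exchangeable M X \<and>
    (\<forall>n \<sigma>. \<sigma> 0 = i0 \<and> directed_path E \<sigma> n \<and> (\<forall>k<n. \<sigma> (Suc k) \<noteq> star (\<sigma> k)) \<longrightarrow>
       \<P>(\<omega> in M. \<forall>k\<le>n. X k \<omega> = \<sigma> k) =
         gamma_const V E star V1 R (\<sigma> n) (reinforced star \<alpha> \<sigma> n) /
         gamma_const V E star V1 R (\<sigma> 0) \<alpha>)"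
proof -
  interpret star_errw V E star \<alpha> i0 M X
    by fact
  interpret star_weights V E star \<alpha>
    using assms by unfold_locales auto
  have bal: "balanced_at i0"
    using assms by (simp add: balanced_at_def)
  let ?P = "\<lambda>n \<sigma>. \<P>(\<omega> in M. \<forall>k\<le>n. X k \<omega> = \<sigma> k)"
  \<comment> \<open>The corrected constant makes this hold also for paths that cross self-dual
    edges, which exchangeability has to include.\<close>
  have formula: "?P n \<sigma> = path_const V E star V1 R (\<sigma> n) (reinforced star \<alpha> \<sigma> n) /
      path_const V E star V1 R i0 \<alpha>" if "\<sigma> 0 = i0" "directed_path E \<sigma> n" for n \<sigma>
    using that(2)
  proof (induction n)
    case 0
    show ?case
      using path_const_pos[OF assms(4,5), of i0] that(1) prob_start[of \<sigma>] by (simp add: reinforced_0)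
  next
    case (Suc n)
    interpret now: star_weights V E star "reinforced star \<alpha> \<sigma> n"
      by (rule star_weights_reinforced)
    have path: "directed_path E \<sigma> n" and e: "(\<sigma> n, \<sigma> (Suc n)) \<in> E"
      using Suc.prems by (auto simp: directed_path_def)
    then have "now.balanced_at (\<sigma> n)"
      using balanced_at_reinforced bal that(1) by blast
    then show ?case
      using Suc.IH[OF path] e now.path_const_step[OF _ e assms(4,5)] prob_path_Suc[of n \<sigma>]
      by (simp add: reinforced_Suc mult.commute)
  qed
  \<comment> \<open>Exchangeability compares arbitrary sequences of states, so those that the walk
    cannot follow have to be treated too.\<close>
  have vanish: "?P n \<sigma> = 0" if "\<not> (\<sigma> 0 = i0 \<and> directed_path E \<sigma> n)" for n \<sigma>
    using that
  proof (induction n)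
    case 0
    then show ?case
      using prob_start[of \<sigma>] by (simp add: directed_path_def)
  next
    case (Suc n)
    then show ?case
      using prob_path_Suc[of n \<sigma>] by (auto simp: directed_path_def less_Suc_eq)
  qed
  have "partially_exchangeable M X"
    unfolding partially_exchangeable_def
  proof (intro allI impI)
    fix n and \<sigma> \<tau> :: "nat \<Rightarrow> 'v"
    assume *: "\<sigma> 0 = \<tau> 0 \<and> (\<forall>i j. transitions \<sigma> n (i, j) = transitions \<tau> n (i, j))"
    then have trans: "transitions \<sigma> n = transitions \<tau> n"
      by auto
    \<comment> \<open>Being a directed path depends only on the transition counts, so
      \<open>\<sigma>\<close> and \<open>\<tau>\<close> always fall into the same case.\<close>
    have dir: "directed_path E \<sigma> n \<longleftrightarrow> (\<forall>e. transitions \<sigma> n e > 0 \<longrightarrow> e \<in> E)" for \<sigma>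
      unfolding directed_path_def transitions_pos_iff by auto
    show "?P n \<sigma> = ?P n \<tau>"
    proof (cases "\<sigma> 0 = i0 \<and> directed_path E \<sigma> n")
      case True
      then have "\<tau> 0 = i0" "directed_path E \<tau> n"
        using * dir trans by auto
      moreover from this have "\<sigma> n = \<tau> n"
        using same_transitions_same_end True * trans finite_V by blast
      moreover have "reinforced star \<alpha> \<sigma> n = reinforced star \<alpha> \<tau> n"
        using trans by (simp add: reinforced_def crossings_def fun_eq_iff)
      ultimately show ?thesis
        using True formula by simp
    next
      case False
      then have "\<not> (\<tau> 0 = i0 \<and> directed_path E \<tau> n)"
        using * dir trans by auto
      then show ?thesis
        using False vanish by simp
    qed
  qed
  moreover have "?P n \<sigma> = gamma_const V E star V1 R (\<sigma> n) (reinforced star \<alpha> \<sigma> n) /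
      gamma_const V E star V1 R (\<sigma> 0) \<alpha>"
    if "\<sigma> 0 = i0" "directed_path E \<sigma> n" "\<forall>k<n. \<sigma> (Suc k) \<noteq> star (\<sigma> k)" for n \<sigma>
    using formula[OF that(1,2)] gamma_const_ratio_eq[OF assms(4,5) that(3)] that(1) by simp
  ultimately show ?thesis
    by blast
qed

end
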